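(* For any integer $r\ge1$, any streaming algorithm that makes $r$ passes over the constraints of a $2$-dimensional linear program with $n$ constraints and finds the optimal solution with probability at least $2/3$ requires $\Omega\left(\frac{1}{r^3}\cdot n^{1/2r}\right)$ space.
   Context: A $2$-dimensional linear program with $n$ constraints is $\min_{x\in\mathbb{R}^2} c_1x_1+c_2x_2$ subject to $n$ linear inequality constraints. In the streaming model the constraints arrive one at a time in a stream, the algorithm makes sequential passes over the stream, and space is the memory (in bits) it uses. *)

theory Defs
  imports "HOL-Probability.Probability"
begin

text \<open>
  The pair \<open>(a, b)\<close> stands for the inequality \<open>a \<bullet> x \<ge> b\<close>;
  an inequality in the other direction is obtained by negating both entries.
\<close>

type_synonym lp_constraint = "(real ^ 2) \<times> real"

definition lp_feasible :: "lp_constraint list \<Rightarrow> real ^ 2 \<Rightarrow> bool" where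
  "lp_feasible cs x \<longleftrightarrow> (\<forall>(a, b) \<in> set cs. a \<bullet> x \<ge> b)"

definition lp_optimal :: "real ^ 2 \<Rightarrow> lp_constraint list \<Rightarrow> real ^ 2 \<Rightarrow> bool" where
  "lp_optimal obj cs x \<longleftrightarrow> is_arg_min (\<lambda>y. obj \<bullet> y) (lp_feasible cs) x"

text \<open>
  Space is measured in bits, so the numbers in the input need a finite precision: no
  finite memory can hold the optimum of a linear program with arbitrary real data.
\<close>

definition word_int :: "nat \<Rightarrow> real \<Rightarrow> bool" where
  "word_int w z \<longleftrightarrow> z \<in> \<int> \<and> \<bar>z\<bar> < 2 ^ w"

definition lp_precision :: "nat \<Rightarrow> real ^ 2 \<Rightarrow> lp_constraint list \<Rightarrow> bool" where
  "lp_precision w obj cs \<longleftrightarrow>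
     (\<forall>i. word_int w (obj $ i)) \<and>
     (\<forall>(a, b) \<in> set cs. (\<forall>i. word_int w (a $ i)) \<and> word_int w b)"

text \<open>
  A multi-pass randomized streaming algorithm in the usual non-uniform model of lower bounds.
  The random tape, the objective vector and the clock (number of the current pass and
  position within it) can be read at no cost; everything else the algorithm knows about
  the constraints seen so far is in its memory, a bit string. The arguments of
  \<open>sa_step\<close> are the tape, the objective, the pass, the position, the arriving constraint
  and the current memory. Fresh private coins are the special case in which every time step
  reads its own block of the tape.
\<close>

type_synonym tape = "nat \<Rightarrow> bool"

record streaming_algorithm =
  sa_init :: "tape \<Rightarrow> real ^ 2 \<Rightarrow> bool list"
  sa_step :: "tape \<Rightarrow> real ^ 2 \<Rightarrow> nat \<Rightarrow> nat \<Rightarrow> lp_constraint \<Rightarrow> bool list \<Rightarrow> bool list"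
  sa_output :: "tape \<Rightarrow> real ^ 2 \<Rightarrow> bool list \<Rightarrow> real ^ 2"

definition uses_space :: "streaming_algorithm \<Rightarrow> nat \<Rightarrow> bool" where
  "uses_space A S \<longleftrightarrow>
     (\<forall>\<omega> obj. length (sa_init A \<omega> obj) \<le> S) \<and>
     (\<forall>\<omega> obj p i h m. length m \<le> S \<longrightarrow> length (sa_step A \<omega> obj p i h m) \<le> S)"

definition run_pass ::
  "streaming_algorithm \<Rightarrow> tape \<Rightarrow> real ^ 2 \<Rightarrow> lp_constraint list \<Rightarrow> nat \<Rightarrow> bool list \<Rightarrow> bool list" where
  "run_pass A \<omega> obj cs p m =
     fold (\<lambda>(i, h). sa_step A \<omega> obj p i h) (List.enumerate 0 cs) m"

primrec memory_after ::
  "streaming_algorithm \<Rightarrow> tape \<Rightarrow> real ^ 2 \<Rightarrow> lp_constraint list \<Rightarrow> nat \<Rightarrow> bool list" where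
  "memory_after A \<omega> obj cs 0 = sa_init A \<omega> obj"
| "memory_after A \<omega> obj cs (Suc p) = run_pass A \<omega> obj cs p (memory_after A \<omega> obj cs p)"

definition sa_result ::
  "streaming_algorithm \<Rightarrow> nat \<Rightarrow> tape \<Rightarrow> real ^ 2 \<Rightarrow> lp_constraint list \<Rightarrow> real ^ 2" where
  "sa_result A r \<omega> obj cs = sa_output A \<omega> obj (memory_after A \<omega> obj cs r)"

definition coin_tape :: "tape measure" where
  "coin_tape = (\<Pi>\<^sub>M i \<in> UNIV. measure_pmf (bernoulli_pmf (1 / 2)))"

text \<open>
  A non-measurable success event has \<open>measure\<close> zero, so a positive lower bound on
  the success probability includes measurability of the event.
\<close>

definition success_prob ::
  "streaming_algorithm \<Rightarrow> nat \<Rightarrow> real ^ 2 \<Rightarrow> lp_constraint list \<Rightarrow> real" where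
  "success_prob A r obj cs =
     measure coin_tape {\<omega> \<in> space coin_tape. lp_optimal obj cs (sa_result A r \<omega> obj cs)}"

text \<open>
  Correctness is demanded for every linear program with \<open>n\<close> constraints and \<open>w\<close>-bit
  integer data that has an optimal solution; if there are several, any of them may be returned.
\<close>

definition finds_lp_optimum ::
  "streaming_algorithm \<Rightarrow> nat \<Rightarrow> nat \<Rightarrow> nat \<Rightarrow> real \<Rightarrow> bool" where
  "finds_lp_optimum A r n w q \<longleftrightarrow>
     (\<forall>obj cs. length cs = n \<and> lp_precision w obj cs \<and> (\<exists>x. lp_optimal obj cs x) \<longrightarrow>
        success_prob A r obj cs \<ge> q)"

end

theory Submission imports Defs begin

text \<open>
  The stream is cut into the lower bounds \<open>y \<ge> u x\<close> of a first player and the upper bounds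
  \<open>y \<le> - l x\<close> of a second player, and \<open>x\<close> is maximised: adding a linear function to every
  \<open>u\<close> and subtracting it from every \<open>l\<close> does not change the optimal \<open>x\<close>. In a hard instance
  with \<open>k + 1\<close> messages, the player who speaks first holds \<open>N\<close> independent instances with
  \<open>k\<close> messages, lifted to tangents of a steep parabola at far apart points so that they do not
  interact, and the other player holds an index \<open>j\<close> and the opposite half of instance \<open>j\<close>.
  Since the roles alternate, \<open>2 r - 1\<close> messages need only about \<open>N ^ r\<close> constraints.

  For a fixed message, the best success probability on instance \<open>j\<close> as a function of the
  first player's data for it has mean at most the \<open>k\<close>-message value, and the average over
  \<open>j\<close> concentrates. A union bound over all messages shows that the first message
  raises the value by at most \<open>\<gamma> + ln |M| / (\<gamma> N)\<close>, where \<open>M\<close> is the set of memory states.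
  The zero-message value is \<open>1 / 2\<close>, so \<open>N = O(r\<^sup>2 S)\<close>.
\<close>

section \<open>Hard instances and the alternating message game\<close>

datatype inst = Unit | Bit (the_bit: bool) | Node (sub: "nat \<Rightarrow> inst") | Idx (idx: nat) (inner: inst)

text \<open>The two families feed each other because the roles swap with every message: a
  \<open>Node\<close> bundles second-player data of the level below, while an \<open>Idx\<close>
  carries first-player data. At level 0 the player about to answer holds \<open>Unit\<close> and the
  other one the unknown bit.\<close>

fun first_inputs :: "nat \<Rightarrow> nat \<Rightarrow> inst set"
  and second_inputs :: "nat \<Rightarrow> nat \<Rightarrow> inst set" where
  "first_inputs N 0 = {Unit}"
| "first_inputs N (Suc k) = Node ` ({..<N} \<rightarrow>\<^sub>E second_inputs N k)"
| "second_inputs N 0 = {Bit False, Bit True}"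
| "second_inputs N (Suc k) = (\<lambda>(j, h). Idx j h) ` ({..<N} \<times> first_inputs N k)"

lemma finite_inputs: "finite (first_inputs N k) \<and> finite (second_inputs N k)"
  by (induction k) (auto intro!: finite_PiE)

lemma nonempty_inputs:
  assumes "N > 0"
  shows "first_inputs N k \<noteq> {} \<and> second_inputs N k \<noteq> {}"
  using assms by (induction k) (auto simp: PiE_eq_empty_iff)

text \<open>Answers at level \<open>k\<close> stay in the interval from 0 to
  \<open>width N k\<close>. Each of the \<open>N\<close> sub-instances gets a slot four times as
  long, so that a point of one answer range is at least three widths away from every foreign
  offset.\<close>

definition width :: "nat \<Rightarrow> nat \<Rightarrow> int" where
  "width N k = (4 * int N) ^ k"

definition offset :: "nat \<Rightarrow> nat \<Rightarrow> nat \<Rightarrow> int" where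
  "offset N k j = 4 * width N k * int j"

primrec answer :: "nat \<Rightarrow> nat \<Rightarrow> inst \<Rightarrow> inst \<Rightarrow> int" where
  "answer N 0 a b = of_bool (the_bit b)"
| "answer N (Suc k) a b = offset N k (idx b) + answer N k (inner b) (sub a (idx b))"

text \<open>Messages are indexed by the number of messages that still follow.\<close>

primrec play ::
  "(nat \<Rightarrow> 'x \<Rightarrow> 'm \<Rightarrow> 'm) \<Rightarrow> ('x \<Rightarrow> 'm \<Rightarrow> 'o) \<Rightarrow> nat \<Rightarrow> 'x \<Rightarrow> 'x \<Rightarrow> 'm \<Rightarrow> 'o" where
  "play msg out 0 x y m = out x m"
| "play msg out (Suc k) x y m = play msg out k y x (msg k x m)"

section \<open>Eliminating messages by concentration and a union bound\<close>

lemma sum_selected_le: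
  fixes U :: "'m \<Rightarrow> nat \<Rightarrow> 'g \<Rightarrow> real" and v \<gamma> :: real
  assumes M: "finite M" and G: "finite G" "G \<noteq> {}" and N: "N > 0"
    and \<gamma>: "0 < \<gamma>" "\<gamma> \<le> 1"
    and sel: "\<And>F. F \<in> {..<N} \<rightarrow>\<^sub>E G \<Longrightarrow> s F \<in> M"
    and U01: "\<And>m j g. 0 \<le> U m j g \<and> U m j g \<le> 1"
    and mean: "\<And>m j. m \<in> M \<Longrightarrow> j < N \<Longrightarrow> (\<Sum>g\<in>G. U m j g) \<le> v * card G"
  shows "(\<Sum>F \<in> {..<N} \<rightarrow>\<^sub>E G. \<Sum>j<N. U (s F) j (F j))
           \<le> N * card ({..<N} \<rightarrow>\<^sub>E G) * (v + \<gamma> + ln (card M) / (\<gamma> * N))"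
proof -
  \<comment> \<open>Exponential moments replace Jensen's inequality: \<open>X \<le> c + (exp (\<gamma> (X - c)) - 1) / \<gamma>\<close>.\<close>
  let ?P = "{..<N} \<rightarrow>\<^sub>E G"
  define X where "X = (\<lambda>m F. \<Sum>j<N. U m j (F j))"
  \<comment> \<open>The threshold \<open>c\<close> satisfies \<gamma> * c = ln (card M) + N *
    (\<gamma> * v + \<gamma>^2): it absorbs the union bound over \<open>M\<close> and the
    \<open>N\<close> moment bounds, so that exp (\<gamma> * (X - c)) has average at most 1.\<close>
  define c where "c = N * (v + \<gamma>) + ln (card M) / \<gamma>"
  have neP: "?P \<noteq> {}" using G by (simp add: PiE_eq_empty_iff)
  then have "M \<noteq> {}" using sel by blast
  then have cM: "real (card M) > 0" using M by (simp add: card_gt_0_iff)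
  have cP: "real (card ?P) = real (card G) ^ N" by (simp add: card_PiE)
  have moment: "(\<Sum>g\<in>G. exp (\<gamma> * U m j g)) \<le> card G * exp (\<gamma> * v + \<gamma>\<^sup>2)"
    if "m \<in> M" "j < N" for m j
  proof -
    have "exp (\<gamma> * U m j g) \<le> 1 + \<gamma> * U m j g + \<gamma>\<^sup>2" for g
    proof -
      have u: "0 \<le> \<gamma> * U m j g" "\<gamma> * U m j g \<le> \<gamma>"
        using U01[of m j g] \<gamma> by (auto intro: mult_left_le)
      then have "exp (\<gamma> * U m j g) \<le> 1 + \<gamma> * U m j g + (\<gamma> * U m j g)\<^sup>2"
        using \<gamma> by (intro exp_bound) linarith+
      moreover have "(\<gamma> * U m j g)\<^sup>2 \<le> \<gamma>\<^sup>2" using u by (intro power_mono) auto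
      ultimately show ?thesis by linarith
    qed
    then have "(\<Sum>g\<in>G. exp (\<gamma> * U m j g)) \<le> (\<Sum>g\<in>G. 1 + \<gamma> * U m j g + \<gamma>\<^sup>2)"
      by (intro sum_mono)
    also have "\<dots> = card G * (1 + \<gamma>\<^sup>2) + \<gamma> * (\<Sum>g\<in>G. U m j g)"
      by (simp add: sum.distrib sum_distrib_left algebra_simps)
    also have "\<dots> \<le> card G * (1 + \<gamma>\<^sup>2) + \<gamma> * (v * card G)"
      using mean[OF that] \<gamma> by (intro add_left_mono mult_left_mono) auto
    also have "\<dots> = card G * (1 + (\<gamma> * v + \<gamma>\<^sup>2))" by (simp add: algebra_simps)
    also have "\<dots> \<le> card G * exp (\<gamma> * v + \<gamma>\<^sup>2)"
      by (intro mult_left_mono exp_ge_add_one_self) auto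
    finally show ?thesis .
  qed
  \<comment> \<open>Summing over all messages removes the dependence of the message on
    \<open>F\<close>. For a fixed message the coordinates of \<open>F\<close> are independent, and
    the moment factorizes.\<close>
  have "(\<Sum>F\<in>?P. exp (\<gamma> * X (s F) F)) \<le> (\<Sum>F\<in>?P. \<Sum>m\<in>M. exp (\<gamma> * X m F))"
    using M sel by (intro sum_mono member_le_sum) auto
  also have "\<dots> = (\<Sum>m\<in>M. \<Sum>F\<in>?P. \<Prod>j<N. exp (\<gamma> * U m j (F j)))"
    unfolding X_def by (subst sum.swap) (simp add: sum_distrib_left exp_sum)
  also have "\<dots> = (\<Sum>m\<in>M. \<Prod>j<N. \<Sum>g\<in>G. exp (\<gamma> * U m j g))"
    using G by (subst prod_sum_PiE) auto
  also have "\<dots> \<le> (\<Sum>m\<in>M. \<Prod>j<N. card G * exp (\<gamma> * v + \<gamma>\<^sup>2))"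
    using moment by (intro sum_mono prod_mono) (auto intro!: sum_nonneg)
  also have "\<dots> = card M * (card ?P * exp (\<gamma> * v + \<gamma>\<^sup>2) ^ N)"
    by (simp add: cP power_mult_distrib)
  also have "\<dots> = card ?P * exp (\<gamma> * c)"
  proof -
    have "\<gamma> * c = ln (card M) + N * (\<gamma> * v + \<gamma>\<^sup>2)"
      using \<gamma> by (simp add: c_def field_simps power2_eq_square)
    then show ?thesis using cM by (simp add: exp_add exp_of_nat_mult)
  qed
  finally have tot: "(\<Sum>F\<in>?P. exp (\<gamma> * X (s F) F)) \<le> card ?P * exp (\<gamma> * c)" .
  have "X (s F) F \<le> c + (exp (\<gamma> * X (s F) F) / exp (\<gamma> * c) - 1) / \<gamma>" for F
  proof -
    have "1 + (\<gamma> * X (s F) F - \<gamma> * c) \<le> exp (\<gamma> * X (s F) F - \<gamma> * c)"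
      by (rule exp_ge_add_one_self)
    then have "\<gamma> * (X (s F) F - c) \<le> exp (\<gamma> * X (s F) F) / exp (\<gamma> * c) - 1"
      by (simp add: exp_diff algebra_simps)
    then have "X (s F) F - c \<le> (exp (\<gamma> * X (s F) F) / exp (\<gamma> * c) - 1) / \<gamma>"
      using \<gamma> by (simp add: pos_le_divide_eq mult.commute)
    then show ?thesis by linarith
  qed
  then have "(\<Sum>F\<in>?P. X (s F) F)
      \<le> (\<Sum>F\<in>?P. c + (exp (\<gamma> * X (s F) F) / exp (\<gamma> * c) - 1) / \<gamma>)"
    by (intro sum_mono)
  also have "\<dots> = card ?P * c
      + ((\<Sum>F\<in>?P. exp (\<gamma> * X (s F) F)) / exp (\<gamma> * c) - card ?P) / \<gamma>"
    by (simp add: sum.distrib sum_subtractf flip: sum_divide_distrib)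
  also have "\<dots> \<le> card ?P * c"
    using tot \<gamma> by (simp add: divide_le_0_iff pos_divide_le_eq)
  also have "\<dots> = N * card ?P * (v + \<gamma> + ln (card M) / (\<gamma> * N))"
    using N \<gamma> by (simp add: c_def field_simps)
  finally show ?thesis by (simp add: X_def)
qed

text \<open>After the first message the game continues on instance \<open>j\<close>, with its answer
  shifted by \<open>offset N k j\<close> and its data embedded into larger inputs. The arbitrary
  shift \<open>t\<close> and encodings \<alpha>, \<beta> make the claim stable under this
  passage.\<close>

lemma play_success_le:
  fixes out :: "'x \<Rightarrow> 'm \<Rightarrow> real" and \<gamma> t :: real
  assumes M: "finite M" "m \<in> M" and closed: "\<And>i x m. m \<in> M \<Longrightarrow> msg i x m \<in> M"
    and N: "N > 0" and \<gamma>: "0 < \<gamma>" "\<gamma> \<le> 1"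
  shows "(\<Sum>a\<in>first_inputs N k. \<Sum>b\<in>second_inputs N k.
            of_bool (play msg out k (\<alpha> a) (\<beta> b) m = t + answer N k a b))
         \<le> (1 / 2 + k * (\<gamma> + ln (card M) / (\<gamma> * N)))
             * (card (first_inputs N k) * card (second_inputs N k))"
  using M(2)
proof (induction k arbitrary: \<alpha> \<beta> m t)
  case 0
  \<comment> \<open>The output sees only \<open>Unit\<close>, so it is right for at most one of the
    two bits.\<close>
  then show ?case by (auto simp: of_bool_def)
next
  case (Suc k)
  let ?D1 = "first_inputs N k" and ?D2 = "second_inputs N k"
  let ?P = "{..<N} \<rightarrow>\<^sub>E ?D2"
  define v where "v = 1 / 2 + k * (\<gamma> + ln (card M) / (\<gamma> * N))"
  define V where "V = (\<lambda>\<mu> j g F. (\<Sum>h\<in>?D1. of_bool (play msg out k (\<beta> (Idx j h)) (\<alpha> (Node F)) \<mu>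
                         = (t + offset N k j) + answer N k h g)) / real (card ?D1))"
  \<comment> \<open>Given the message, the first player may as well simulate the best completion \<open>F\<close> of its
    sub-instance \<open>g\<close>, whatever \<open>F\<close> is; this turns the rest of the play into a \<open>k\<close>-message protocol.\<close>
  define U where "U = (\<lambda>\<mu> j g. Max (V \<mu> j g ` ?P))"
  have fin: "finite ?D1" "finite ?D2" using finite_inputs by auto
  have ne: "?D1 \<noteq> {}" "?D2 \<noteq> {}" using nonempty_inputs[OF N] by auto
  have finP: "finite ?P" using fin by (intro finite_PiE) auto
  have neP: "?P \<noteq> {}" using ne by (simp add: PiE_eq_empty_iff)
  have c1: "real (card ?D1) > 0" using fin ne by (simp add: card_gt_0_iff)
  have V_card: "card ?D1 * V \<mu> j g F = (\<Sum>h\<in>?D1. of_bool (play msg out k (\<beta> (Idx j h)) (\<alpha> (Node F)) \<mu>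
                         = (t + offset N k j) + answer N k h g))" for \<mu> j g F
    using c1 by (simp add: V_def)
  have V01: "0 \<le> V \<mu> j g F \<and> V \<mu> j g F \<le> 1" for \<mu> j g F
  proof -
    have "(\<Sum>h\<in>?D1. of_bool (play msg out k (\<beta> (Idx j h)) (\<alpha> (Node F)) \<mu>
                         = (t + offset N k j) + answer N k h g)) \<le> (\<Sum>h\<in>?D1. 1 :: real)"
      by (intro sum_mono) auto
    then show ?thesis using c1 by (auto simp: V_def sum_nonneg pos_divide_le_eq)
  qed
  have U_attained: "\<exists>F\<in>?P. U \<mu> j g = V \<mu> j g F" for \<mu> j g
  proof -
    have "U \<mu> j g \<in> V \<mu> j g ` ?P" unfolding U_def using finP neP by (intro Max_in) auto
    then show ?thesis by blast
  qed
  then obtain \<phi> where \<phi>: "\<And>\<mu> j g. \<phi> \<mu> j g \<in> ?P \<and> U \<mu> j g = V \<mu> j g (\<phi> \<mu> j g)"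
    by metis
  have V_le_U: "V \<mu> j g F \<le> U \<mu> j g" if "F \<in> ?P" for \<mu> j g F
    unfolding U_def using finP that by (intro Max_ge) auto
  have U01: "0 \<le> U \<mu> j g \<and> U \<mu> j g \<le> 1" for \<mu> j g
    using \<phi> V01 by metis
  have mean: "(\<Sum>g\<in>?D2. U \<mu> j g) \<le> v * card ?D2" if "\<mu> \<in> M" for \<mu> j
  proof -
    have "real (card ?D1) * (\<Sum>g\<in>?D2. U \<mu> j g)
        = (\<Sum>g\<in>?D2. \<Sum>h\<in>?D1. of_bool (play msg out k (\<beta> (Idx j h)) (\<alpha> (Node (\<phi> \<mu> j g))) \<mu>
                         = (t + offset N k j) + answer N k h g))"
      using \<phi> by (simp only: sum_distrib_left V_card)
    also have "\<dots> = (\<Sum>h\<in>?D1. \<Sum>g\<in>?D2. of_bool (play msg out k (\<beta> (Idx j h)) (\<alpha> (Node (\<phi> \<mu> j g))) \<mu>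
                         = (t + offset N k j) + answer N k h g))"
      by (rule sum.swap)
    \<comment> \<open>The former second player, holding \<open>h\<close>, now speaks first. For
      fixed \<mu> and \<open>j\<close> the completion \<phi> depends on \<open>g\<close> alone, so
      both arguments are legitimate encodings of level \<open>k\<close> data.\<close>
    also have "\<dots> \<le> v * (card ?D1 * card ?D2)"
      unfolding v_def
      using Suc.IH[OF that, of "\<lambda>h. \<beta> (Idx j h)" "\<lambda>g. \<alpha> (Node (\<phi> \<mu> j g))" "t + offset N k j"]
      by simp
    finally have "real (card ?D1) * (\<Sum>g\<in>?D2. U \<mu> j g) \<le> real (card ?D1) * (v * card ?D2)"
      by (simp add: algebra_simps)
    then show ?thesis using c1 by simp
  qed
  let ?s = "\<lambda>F. msg k (\<alpha> (Node F)) m"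
  have inj1: "inj_on Node A" and inj2: "inj_on (\<lambda>(j, h). Idx j h) B" for A B
    by (auto simp: inj_on_def)
  have card1: "card (first_inputs N (Suc k)) = card ?P"
    by (simp add: card_image inj1)
  have card2: "card (second_inputs N (Suc k)) = N * card ?D1"
    by (simp add: card_image inj2 card_cartesian_product)
  have "(\<Sum>a\<in>first_inputs N (Suc k). \<Sum>b\<in>second_inputs N (Suc k).
            of_bool (play msg out (Suc k) (\<alpha> a) (\<beta> b) m = t + answer N (Suc k) a b))
      = (\<Sum>F\<in>?P. \<Sum>(j, h)\<in>{..<N} \<times> ?D1. of_bool (play msg out k (\<beta> (Idx j h)) (\<alpha> (Node F)) (?s F)
                         = (t + offset N k j) + answer N k h (F j)))"
    unfolding first_inputs.simps second_inputs.simps sum.reindex[OF inj1] sum.reindex[OF inj2]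
    by (intro sum.cong refl) (simp add: case_prod_unfold add.assoc)
  also have "\<dots> = (\<Sum>F\<in>?P. \<Sum>j<N. \<Sum>h\<in>?D1. of_bool (play msg out k (\<beta> (Idx j h)) (\<alpha> (Node F)) (?s F)
                         = (t + offset N k j) + answer N k h (F j)))"
    by (intro sum.cong refl) (rule sum.cartesian_product[symmetric])
  also have "\<dots> = (\<Sum>F\<in>?P. \<Sum>j<N. card ?D1 * V (?s F) j (F j) F)"
    by (simp only: V_card)
  also have "\<dots> \<le> (\<Sum>F\<in>?P. \<Sum>j<N. card ?D1 * U (?s F) j (F j))"
    using V_le_U by (intro sum_mono mult_left_mono) auto
  also have "\<dots> = card ?D1 * (\<Sum>F\<in>?P. \<Sum>j<N. U (?s F) j (F j))"
    by (simp add: sum_distrib_left)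
  also have "\<dots> \<le> card ?D1 * (N * card ?P * (v + \<gamma> + ln (card M) / (\<gamma> * N)))"
    using M fin ne N \<gamma> closed[OF Suc.prems] U01 mean
    by (intro mult_left_mono sum_selected_le) auto
  also have "\<dots> = (1 / 2 + Suc k * (\<gamma> + ln (card M) / (\<gamma> * N)))
             * (card (first_inputs N (Suc k)) * card (second_inputs N (Suc k)))"
  proof -
    have "v + \<gamma> + L = 1 / 2 + Suc k * (\<gamma> + L)" if "L = ln (card M) / (\<gamma> * N)" for L
      unfolding v_def that[symmetric] by (simp add: algebra_simps)
    then show ?thesis unfolding card1 card2 by simp
  qed
  finally show ?case .
qed

section \<open>Geometry: embedding the instances as families of lines\<close>

text \<open>A line \<open>(a, b)\<close> is the function \<open>a x + b\<close>; shearing translates it by \<open>s\<close> and adds the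
  tangent of \<open>C x\<^sup>2\<close> at \<open>s\<close>.\<close>

definition shear :: "int \<Rightarrow> int \<Rightarrow> int \<times> int \<Rightarrow> int \<times> int" where
  "shear C s = (\<lambda>(a, b). (a + 2 * C * s, b - a * s - C * s\<^sup>2))"

text \<open>The steepness \<open>3 ^ (k - 1)\<close> matches the coefficient bound of the level
  below. The opposite signs for \<open>Node\<close> and \<open>Idx\<close> make the added tangents
  cancel within the selected instance.\<close>

primrec lines :: "nat \<Rightarrow> inst \<Rightarrow> nat \<Rightarrow> (int \<times> int) list" where
  "lines N Unit k = [(0, 0)]"
| "lines N (Bit b) k = [(1, - of_bool b)]"
| "lines N (Node F) k =
     concat (map (\<lambda>j. map (shear (3 ^ (k - 1)) (offset N (k - 1) j)) (lines N (F j) (k - 1))) [0..<N])"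
| "lines N (Idx j h) k = map (shear (- (3 ^ (k - 1))) (offset N (k - 1) j)) (lines N h (k - 1))"

definition line_at :: "int \<times> int \<Rightarrow> int \<Rightarrow> int" where
  "line_at u x = fst u * x + snd u"

lemma line_at_shear:
  "line_at (shear C s u) x = line_at u (x - s) + C * (x\<^sup>2 - (x - s)\<^sup>2)"
  by (simp add: line_at_def shear_def case_prod_unfold algebra_simps power2_eq_square)

text \<open>Only a \<open>Node\<close> multiplies the number of lines by \<open>N\<close>, and each
  player holds one on every second level only; hence the halved exponents.\<close>

lemma length_lines:
  "(\<forall>a\<in>first_inputs N k. length (lines N a k) = N ^ ((k + 1) div 2)) \<and>
   (\<forall>b\<in>second_inputs N k. length (lines N b k) = N ^ (k div 2))"
proof (induction k)
  case (Suc k)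
  have "length (lines N (Node F) (Suc k)) = N ^ ((Suc k + 1) div 2)"
    if "F \<in> {..<N} \<rightarrow>\<^sub>E second_inputs N k" for F
  proof -
    have "(\<Sum>j\<leftarrow>[0..<N]. length (lines N (F j) k)) = (\<Sum>j\<leftarrow>[0..<N]. N ^ (k div 2))"
      using Suc that by (intro arg_cong[where f = sum_list] map_cong) (auto simp: PiE_mem)
    then show ?thesis by (simp add: length_concat comp_def sum_list_triv)
  qed
  then show ?case using Suc by auto
qed simp

lemma width_ge_1: "N > 0 \<Longrightarrow> width N k \<ge> 1"
  unfolding width_def by (rule one_le_power) simp

lemma offset_bounds:
  assumes "j < N"
  shows "0 \<le> offset N k j" "offset N k j + 4 * width N k \<le> width N (Suc k)"
proof -
  have w: "width N k \<ge> 1" using assms by (intro width_ge_1) auto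
  then show "0 \<le> offset N k j" by (simp add: offset_def)
  have "4 * width N k * (int j + 1) \<le> 4 * width N k * int N"
    using w assms by (intro mult_left_mono) auto
  then show "offset N k j + 4 * width N k \<le> width N (Suc k)"
    by (simp add: offset_def width_def algebra_simps)
qed

definition bounded_line :: "nat \<Rightarrow> nat \<Rightarrow> int \<times> int \<Rightarrow> bool" where
  "bounded_line N k u \<longleftrightarrow> \<bar>fst u\<bar> \<le> 3 ^ k * width N k \<and> \<bar>snd u\<bar> \<le> 3 ^ k * (width N k)\<^sup>2"

text \<open>With the new width, the slope a + 2 C s and the intercept b - a s - C s^2 are each at
  most three times the old bound's form. This is the source of the factor 3 per level.\<close>

lemma bounded_line_shear:
  assumes u: "bounded_line N k u" and j: "j < N" and C: "\<bar>C\<bar> = 3 ^ k"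
  shows "bounded_line N (Suc k) (shear C (offset N k j) u)"
proof -
  define W W' s B where "W = width N k" and "W' = width N (Suc k)" and "s = offset N k j"
    and "B = (3 :: int) ^ k"
  have W: "1 \<le> W" "W \<le> W'" "0 \<le> s" "s \<le> W'"
    using width_ge_1[of N k] j offset_bounds[OF j, of k] unfolding W_def W'_def s_def by auto
  have B: "0 \<le> B" by (simp add: B_def)
  obtain a b where ab: "u = (a, b)" by fastforce
  have a: "\<bar>a\<bar> \<le> B * W" and b: "\<bar>b\<bar> \<le> B * W\<^sup>2"
    using u by (auto simp: bounded_line_def ab B_def W_def)
  have a': "\<bar>a\<bar> \<le> B * W'" using a W B by (meson mult_left_mono order_trans)
  have b': "\<bar>b\<bar> \<le> B * W'\<^sup>2"
    using b W B by (meson mult_left_mono order_trans power_mono zero_le_one)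
  have Cs: "\<bar>C * s\<bar> \<le> B * W'" using W B C by (simp add: abs_mult B_def mult_left_mono)
  have as: "\<bar>a * s\<bar> \<le> B * W'\<^sup>2"
    using mult_mono[OF a' W(4)] W B by (simp add: abs_mult power2_eq_square mult.assoc)
  have Css: "\<bar>C * s\<^sup>2\<bar> \<le> B * W'\<^sup>2"
    using W B C by (simp add: abs_mult B_def mult_left_mono power_mono)
  have "\<bar>a + 2 * C * s\<bar> \<le> 3 * B * W'" using a' Cs by (simp add: abs_le_iff)
  moreover have "\<bar>b - a * s - C * s\<^sup>2\<bar> \<le> 3 * B * W'\<^sup>2" using b' as Css by (simp add: abs_le_iff)
  ultimately show ?thesis
    by (simp add: bounded_line_def shear_def ab W'_def[symmetric] s_def[symmetric] B_def)
qed

lemma bounded_lines: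
  assumes "N > 0"
  shows "\<forall>d \<in> first_inputs N k \<union> second_inputs N k. \<forall>u \<in> set (lines N d k). bounded_line N k u"
proof (induction k)
  case 0
  then show ?case by (auto simp: bounded_line_def width_def)
next
  case (Suc k)
  show ?case
  proof (intro ballI)
    fix d u
    assume "d \<in> first_inputs N (Suc k) \<union> second_inputs N (Suc k)" and u: "u \<in> set (lines N d (Suc k))"
    then consider
      F where "F \<in> {..<N} \<rightarrow>\<^sub>E second_inputs N k" "d = Node F"
      | j h where "j < N" "h \<in> first_inputs N k" "d = Idx j h"
      by auto
    then show "bounded_line N (Suc k) u"
    proof cases
      case (1 F)
      then obtain j l where "j < N" "l \<in> set (lines N (F j) k)" "u = shear (3 ^ k) (offset N k j) l"
        using u by auto
      moreover have "F j \<in> second_inputs N k" using 1 \<open>j < N\<close> by (auto simp: PiE_mem)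
      ultimately show ?thesis using Suc.IH by (auto intro!: bounded_line_shear)
    next
      case (2 j h)
      then obtain l where "l \<in> set (lines N h k)" "u = shear (- (3 ^ k)) (offset N k j) l"
        using u by auto
      then show ?thesis using Suc.IH 2 by (auto intro!: bounded_line_shear)
    qed
  qed
qed

text \<open>Some y satisfies u(x) <= y <= -l(x) for all pairs iff all sums u(x) + l(x) are at most
  0; a tight pair with increasing sum forbids any larger x. The condition is symmetric in the two
  sets, so it survives the swap of roles.\<close>

definition crossing :: "(int \<times> int) set \<Rightarrow> (int \<times> int) set \<Rightarrow> int \<Rightarrow> bool" where
  "crossing us ls x \<longleftrightarrow>
     (\<forall>u\<in>us. \<forall>l\<in>ls. line_at u x + line_at l x \<le> 0) \<and>
     (\<exists>u\<in>us. \<exists>l\<in>ls. line_at u x + line_at l x = 0 \<and> fst u + fst l > 0)"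

text \<open>Here \<tau> and \<open>x\<close> are the positions of one point relative to a foreign
  and to the selected offset, and the right-hand side is the margin left by the parabolas. It equals
  B (|\<tau>| - x) (|\<tau>| + x), at least 2 B W (|\<tau>| + x); one half pays for the slopes and
  the other for the intercepts.\<close>

lemma sheared_lines_below:
  fixes x \<tau> B W :: int
  assumes u: "\<bar>fst u\<bar> \<le> B * W" "\<bar>snd u\<bar> \<le> B * W\<^sup>2"
    and l: "\<bar>fst l\<bar> \<le> B * W" "\<bar>snd l\<bar> \<le> B * W\<^sup>2"
    and x: "0 \<le> x" "x \<le> W" and \<tau>: "3 * W \<le> \<bar>\<tau>\<bar>" and B: "0 \<le> B"
  shows "line_at u \<tau> + line_at l x \<le> B * (\<tau>\<^sup>2 - x\<^sup>2)"
proof -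
  have "fst u * \<tau> \<le> \<bar>fst u\<bar> * \<bar>\<tau>\<bar>" by (metis abs_ge_self abs_mult)
  also have "\<dots> \<le> B * W * \<bar>\<tau>\<bar>" using u by (intro mult_right_mono) auto
  finally have 1: "fst u * \<tau> \<le> B * W * \<bar>\<tau>\<bar>" .
  have 2: "fst l * x \<le> B * W * x" using l x by (intro mult_right_mono) auto
  have "B * ((2 * W) * (\<bar>\<tau>\<bar> + x)) \<le> B * ((\<bar>\<tau>\<bar> - x) * (\<bar>\<tau>\<bar> + x))"
    using x \<tau> B by (intro mult_left_mono mult_right_mono) auto
  also have "\<dots> = B * (\<bar>\<tau>\<bar>\<^sup>2 - x\<^sup>2)" by (simp add: algebra_simps power2_eq_square)
  finally have 3: "2 * (B * W * (\<bar>\<tau>\<bar> + x)) \<le> B * (\<tau>\<^sup>2 - x\<^sup>2)" by (simp add: algebra_simps)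
  have "B * W * (2 * W) \<le> B * W * (\<bar>\<tau>\<bar> + x)"
    using x \<tau> B by (intro mult_left_mono) auto
  then have 4: "2 * (B * W\<^sup>2) \<le> B * W * (\<bar>\<tau>\<bar> + x)"
    by (simp add: power2_eq_square algebra_simps)
  have 5: "snd u + snd l \<le> 2 * (B * W\<^sup>2)" using u l by linarith
  have "B * W * (\<bar>\<tau>\<bar> + x) = B * W * \<bar>\<tau>\<bar> + B * W * x" by (rule distrib_left)
  then show ?thesis using 1 2 3 4 5 unfolding line_at_def by linarith
qed

text \<open>The induction hypothesis is used with swapped roles, for \<open>h\<close> against
  \<open>F j\<close>. Pairs from instance \<open>j\<close> are its pairs translated; pairs from
  other instances are separated by the parabola, for which the range of the answer has to be carried
  along.\<close>

lemma crossing_answer: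
  assumes N: "N > 0" and "a \<in> first_inputs N k" "b \<in> second_inputs N k"
  shows "0 \<le> answer N k a b \<and> answer N k a b \<le> width N k \<and>
         crossing (set (lines N a k)) (set (lines N b k)) (answer N k a b)"
  using assms(2,3)
proof (induction k arbitrary: a b)
  case 0
  then show ?case by (auto simp: crossing_def line_at_def width_def)
next
  case (Suc k)
  from Suc.prems obtain F j h where ab: "a = Node F" "b = Idx j h"
    and F: "F \<in> {..<N} \<rightarrow>\<^sub>E second_inputs N k" and j: "j < N" and h: "h \<in> first_inputs N k"
    by auto
  have Fj: "F i \<in> second_inputs N k" if "i < N" for i using F that by (auto simp: PiE_mem)
  define x W s B where "x = answer N k h (F j)" and "W = width N k" and "s = offset N k j"
    and "B = (3 :: int) ^ k"
  have IH: "0 \<le> x" "x \<le> W" "crossing (set (lines N h k)) (set (lines N (F j) k)) x"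
    using Suc.IH[OF h Fj[OF j]] unfolding x_def W_def by auto
  have W: "W \<ge> 1" using N width_ge_1 unfolding W_def by auto
  have ans: "answer N (Suc k) a b = s + x" by (simp add: ab s_def x_def)
  have lines_a: "set (lines N a (Suc k)) = (\<Union>i<N. shear B (offset N k i) ` set (lines N (F i) k))"
    by (auto simp: ab B_def)
  have lines_b: "set (lines N b (Suc k)) = shear (- B) s ` set (lines N h k)"
    by (simp add: ab B_def s_def)
  have own: "line_at (shear B s u) (s + x) + line_at (shear (- B) s l) (s + x)
      = line_at l x + line_at u x" for u l
    by (simp add: line_at_shear)
  have other: "line_at (shear B (offset N k i) u) (s + x) + line_at (shear (- B) s l) (s + x) \<le> 0"
    if i: "i < N" "i \<noteq> j" and u: "u \<in> set (lines N (F i) k)" and l: "l \<in> set (lines N h k)" for i u l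
  proof -
    let ?\<tau> = "s + x - offset N k i"
    have "bounded_line N k u" "bounded_line N k l"
      using bounded_lines[OF N, of k] u l Fj[OF i(1)] h by blast+
    then have bds: "\<bar>fst u\<bar> \<le> B * W" "\<bar>snd u\<bar> \<le> B * W\<^sup>2" "\<bar>fst l\<bar> \<le> B * W" "\<bar>snd l\<bar> \<le> B * W\<^sup>2"
      by (auto simp: bounded_line_def B_def W_def)
    have \<tau>: "?\<tau> = 4 * W * (int j - int i) + x"
      by (simp add: s_def offset_def W_def algebra_simps)
    have "3 * W \<le> \<bar>?\<tau>\<bar>"
    proof (cases "i < j")
      case True
      then have "4 * W * 1 \<le> 4 * W * (int j - int i)" using W by (intro mult_left_mono) auto
      then show ?thesis using \<tau> IH by linarith
    next
      case False
      then have "4 * W * (int j - int i) \<le> 4 * W * (- 1)" using W i by (intro mult_left_mono) auto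
      then show ?thesis using \<tau> IH by linarith
    qed
    then have "line_at u ?\<tau> + line_at l x \<le> B * (?\<tau>\<^sup>2 - x\<^sup>2)"
      using bds IH by (intro sheared_lines_below) (auto simp: B_def)
    then show ?thesis by (simp add: line_at_shear algebra_simps)
  qed
  have "line_at u (s + x) + line_at l (s + x) \<le> 0"
    if u: "u \<in> set (lines N a (Suc k))" and l: "l \<in> set (lines N b (Suc k))" for u l
  proof -
    obtain i u0 l0 where i: "i < N" "u = shear B (offset N k i) u0" "u0 \<in> set (lines N (F i) k)"
      and l0: "l = shear (- B) s l0" "l0 \<in> set (lines N h k)"
      using u l unfolding lines_a lines_b by blast
    show ?thesis
    proof (cases "i = j")
      case True
      then show ?thesis using i l0 IH(3) own unfolding crossing_def by (auto simp: s_def)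
    next
      case False
      then show ?thesis using i l0 other by auto
    qed
  qed
  moreover have "\<exists>u\<in>set (lines N a (Suc k)). \<exists>l\<in>set (lines N b (Suc k)).
      line_at u (s + x) + line_at l (s + x) = 0 \<and> fst u + fst l > 0"
  proof -
    obtain u l where "l \<in> set (lines N h k)" "u \<in> set (lines N (F j) k)"
      and 0: "line_at l x + line_at u x = 0" "fst l + fst u > 0"
      using IH(3) unfolding crossing_def by blast
    then have "shear B s u \<in> set (lines N a (Suc k))" "shear (- B) s l \<in> set (lines N b (Suc k))"
      unfolding lines_a lines_b s_def using j by auto
    moreover have "fst (shear B s u) + fst (shear (- B) s l) > 0"
      using 0 by (simp add: shear_def case_prod_unfold)
    ultimately show ?thesis using own 0 by metis
  qed
  moreover have "0 \<le> s + x" "s + x \<le> width N (Suc k)"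
    using offset_bounds[OF j, of k] IH W unfolding s_def W_def by linarith+
  ultimately show ?case unfolding ans crossing_def by blast
qed

section \<open>From lines to linear programs\<close>

definition above_line :: "int \<times> int \<Rightarrow> lp_constraint" where
  "above_line u = (vector [- of_int (fst u), 1], of_int (snd u))"

definition below_line :: "int \<times> int \<Rightarrow> lp_constraint" where
  "below_line l = (vector [- of_int (fst l), -1], of_int (snd l))"

definition rightmost :: "real ^ 2" where
  "rightmost = vector [-1, 0]"

definition first_part :: "nat \<Rightarrow> nat \<Rightarrow> inst \<Rightarrow> lp_constraint list" where
  "first_part N k a = map above_line (lines N a k)"

text \<open>Correctness concerns exactly \<open>n\<close> constraints, so the vacuous constraint 0
  \<ge> 0 pads the list. Padding at the end keeps the first part at its own length, where the pass
  is split.\<close>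

definition second_part :: "nat \<Rightarrow> nat \<Rightarrow> nat \<Rightarrow> inst \<Rightarrow> lp_constraint list" where
  "second_part n N k b = map below_line (lines N b k)
     @ replicate (n - N ^ ((k + 1) div 2) - N ^ (k div 2)) (0, 0)"

lemma lp_feasible_parts:
  "lp_feasible (first_part N k a @ second_part n N k b) z \<longleftrightarrow>
     (\<forall>u\<in>set (lines N a k). of_int (fst u) * z $ 1 + of_int (snd u) \<le> z $ 2) \<and>
     (\<forall>l\<in>set (lines N b k). of_int (fst l) * z $ 1 + of_int (snd l) \<le> - z $ 2)"
  unfolding lp_feasible_def first_part_def second_part_def above_line_def below_line_def
  by (auto simp: ball_Un inner_vec_def sum_2 algebra_simps)

text \<open>Adding the two constraints of the tight pair eliminates the second coordinate and bounds
  the first by \<open>x\<close>; the point on the tight pair attains this. The first coordinate is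
  all that the game reads.\<close>

lemma lp_optimal_crossing:
  fixes n :: nat
  assumes "crossing (set (lines N a k)) (set (lines N b k)) x"
  defines "cs \<equiv> first_part N k a @ second_part n N k b"
  shows "\<exists>z. lp_optimal rightmost cs z"
    and "lp_optimal rightmost cs z \<Longrightarrow> z $ 1 = of_int x"
proof -
  obtain u l where ul: "u \<in> set (lines N a k)" "l \<in> set (lines N b k)"
    and 0: "line_at u x + line_at l x = 0" and pos: "fst u + fst l > 0"
    using assms(1) unfolding crossing_def by blast
  have below: "line_at u' x + line_at l' x \<le> 0"
    if "u' \<in> set (lines N a k)" "l' \<in> set (lines N b k)" for u' l'
    using assms(1) that unfolding crossing_def by blast
  define p :: "real ^ 2" where "p = vector [of_int x, of_int (line_at u x)]"
  have obj: "rightmost \<bullet> z = - z $ 1" for z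
    by (simp add: rightmost_def inner_vec_def sum_2)
  have p: "lp_feasible cs p"
    unfolding cs_def lp_feasible_parts
  proof (intro conjI ballI)
    fix u' assume "u' \<in> set (lines N a k)"
    then have "line_at u' x \<le> line_at u x" using below[OF _ ul(2)] 0 by fastforce
    then show "of_int (fst u') * p $ 1 + of_int (snd u') \<le> p $ 2"
      by (simp add: p_def line_at_def flip: of_int_mult of_int_add)
  next
    fix l' assume "l' \<in> set (lines N b k)"
    then have "line_at l' x \<le> - line_at u x" using below[OF ul(1)] by fastforce
    then show "of_int (fst l') * p $ 1 + of_int (snd l') \<le> - p $ 2"
      by (simp add: p_def line_at_def flip: of_int_mult of_int_add of_int_minus)
  qed
  have le: "z $ 1 \<le> of_int x" if "lp_feasible cs z" for z
  proof -
    have "of_int (fst u) * z $ 1 + of_int (snd u) + (of_int (fst l) * z $ 1 + of_int (snd l)) \<le> 0"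
      using that ul unfolding cs_def lp_feasible_parts by fastforce
    moreover have "real_of_int (fst u * x + snd u + (fst l * x + snd l)) = 0"
      using 0 by (simp add: line_at_def)
    ultimately have "of_int (fst u + fst l) * (z $ 1 - of_int x) \<le> 0"
      by (simp add: algebra_simps)
    then show ?thesis using pos by (simp add: mult_le_0_iff)
  qed
  have "lp_optimal rightmost cs p"
    using p le by (fastforce simp: lp_optimal_def is_arg_min_def obj p_def)
  then show "\<exists>z. lp_optimal rightmost cs z" ..
  show "z $ 1 = of_int x" if "lp_optimal rightmost cs z"
    using that p le by (fastforce simp: lp_optimal_def is_arg_min_def obj p_def)
qed


lemma lp_precision_parts:
  assumes N: "N > 0" and "a \<in> first_inputs N k" "b \<in> second_inputs N k"
    and w: "3 ^ k * (width N k)\<^sup>2 < 2 ^ w"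
  shows "lp_precision w rightmost (first_part N k a @ second_part n N k b)"
proof -
  have W: "width N k \<ge> 1" using N by (rule width_ge_1)
  have one: "(1::real) < 2 ^ w"
  proof -
    have "(1::int) * 1 \<le> 3 ^ k * (width N k)\<^sup>2" using W by (intro mult_mono) auto
    then have "(1::int) < 2 ^ w" using w by linarith
    then show ?thesis by (metis of_int_1 of_int_less_iff of_int_numeral of_int_power)
  qed
  have word: "word_int w (of_int z)" if "\<bar>z\<bar> \<le> 3 ^ k * (width N k)\<^sup>2" for z
  proof -
    have "\<bar>z\<bar> < 2 ^ w" using that w by linarith
    then have "real_of_int \<bar>z\<bar> < of_int (2 ^ w)" by (simp only: of_int_less_iff)
    then show ?thesis by (simp add: word_int_def)
  qed
  have line: "word_int w (of_int (fst u)) \<and> word_int w (of_int (snd u))"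
    if "u \<in> set (lines N a k) \<union> set (lines N b k)" for u
  proof -
    have u: "bounded_line N k u" using bounded_lines[OF N, of k] assms that by blast
    have "3 ^ k * width N k * 1 \<le> 3 ^ k * width N k * width N k"
      using W by (intro mult_left_mono) auto
    then have "3 ^ k * width N k \<le> 3 ^ k * (width N k)\<^sup>2"
      by (simp only: power2_eq_square mult.assoc mult_1_right)
    then show ?thesis using u unfolding bounded_line_def by (meson order_trans word)
  qed
  have neg: "word_int w (- z) \<longleftrightarrow> word_int w z" for z
    by (simp add: word_int_def)
  have "word_int w 1" "word_int w 0" using one by (auto simp: word_int_def)
  then have "word_int w 1 \<and> word_int w 0" by simp
  then show ?thesis
    unfolding lp_precision_def first_part_def second_part_def above_line_def below_line_def rightmost_def
    by (auto simp: forall_2 neg dest!: line[OF UnI1] line[OF UnI2])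
qed

section \<open>Streaming algorithms as message protocols\<close>

definition pass_from ::
  "streaming_algorithm \<Rightarrow> tape \<Rightarrow> nat \<Rightarrow> nat \<Rightarrow> lp_constraint list \<Rightarrow> bool list \<Rightarrow> bool list" where
  "pass_from A \<omega> p i cs = fold (\<lambda>(i, h). sa_step A \<omega> rightmost p i h) (List.enumerate i cs)"

text \<open>With \<open>t\<close> messages still to come, the holder of the first part speaks iff
  \<open>t\<close> is even, and the pass number follows from counting back from the last pass. The
  second half of the last pass is no message but part of \<open>stream_out\<close>, which gives
  \<open>2 * r - 1\<close> messages for \<open>r\<close> passes.\<close>

definition stream_msg ::
  "streaming_algorithm \<Rightarrow> tape \<Rightarrow> nat \<Rightarrow> nat \<Rightarrow> nat \<Rightarrow> lp_constraint list \<Rightarrow> bool list \<Rightarrow> bool list" where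
  "stream_msg A \<omega> l r t = pass_from A \<omega> (r - 1 - (t + 1) div 2) (if even t then 0 else l)"

definition stream_out ::
  "streaming_algorithm \<Rightarrow> tape \<Rightarrow> nat \<Rightarrow> nat \<Rightarrow> lp_constraint list \<Rightarrow> bool list \<Rightarrow> real" where
  "stream_out A \<omega> l r cs m = sa_output A \<omega> rightmost (pass_from A \<omega> (r - 1) l cs m) $ 1"

lemma run_pass_append:
  "run_pass A \<omega> rightmost (xs @ ys) p m = pass_from A \<omega> p (length xs) ys (pass_from A \<omega> p 0 xs m)"
  by (simp add: run_pass_def pass_from_def enumerate_append_eq)

text \<open>The induction runs backwards over the passes: the last pass costs one message and each
  of the \<open>q\<close> passes before it costs two.\<close>

lemma play_streaming:
  assumes "q < r"
  shows "play (stream_msg A \<omega> (length xs) r) (stream_out A \<omega> (length xs) r) (Suc (2 * q)) xs ys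
           (memory_after A \<omega> rightmost (xs @ ys) (r - 1 - q))
         = sa_result A r \<omega> rightmost (xs @ ys) $ 1"
  using assms
proof (induction q)
  case 0
  then obtain r' where "r = Suc r'" by (cases r) auto
  then show ?case
    by (simp add: stream_msg_def stream_out_def sa_result_def run_pass_append)
next
  case (Suc q)
  then have e: "Suc (r - 1 - Suc q) = r - 1 - q" by simp
  have "memory_after A \<omega> rightmost (xs @ ys) (r - 1 - q)
      = run_pass A \<omega> rightmost (xs @ ys) (r - 1 - Suc q)
          (memory_after A \<omega> rightmost (xs @ ys) (r - 1 - Suc q))"
    unfolding e[symmetric] by simp
  then show ?case using Suc by (simp add: stream_msg_def run_pass_append)
qed

lemma length_pass_from:
  assumes "uses_space A S" "length m \<le> S"
  shows "length (pass_from A \<omega> p i cs m) \<le> S"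
  using assms(2)
proof (induction cs arbitrary: i m)
  case (Cons c cs)
  then have "length (sa_step A \<omega> rightmost p i c m) \<le> S"
    using assms(1) unfolding uses_space_def by blast
  then show ?case using Cons.IH by (simp add: pass_from_def)
qed (simp add: pass_from_def)

section \<open>Counting memory states and averaging over the tape\<close>

lemma card_bit_strings:
  fixes S :: nat
  shows "finite {m :: bool list. length m \<le> S}"
    and "ln (card {m :: bool list. length m \<le> S}) \<le> 2 * S"
proof -
  have eq: "{m :: bool list. length m \<le> S} = {m. set m \<subseteq> UNIV \<and> length m \<le> S}" by simp
  show fin: "finite {m :: bool list. length m \<le> S}"
    unfolding eq by (rule finite_lists_length_le) simp
  have "card {m :: bool list. length m \<le> S} = (\<Sum>i\<le>S. 2 ^ i)"
    unfolding eq by (subst card_lists_length_le) auto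
  also have "\<dots> \<le> 4 ^ S"
  proof (induction S)
    case (Suc S)
    have "(2::nat) ^ S \<le> 4 ^ S" by (rule power_mono) auto
    then show ?case using Suc by simp
  qed simp
  finally have le: "real (card {m :: bool list. length m \<le> S}) \<le> 4 ^ S"
    by (metis of_nat_le_iff of_nat_numeral of_nat_power)
  have "card {m :: bool list. length m \<le> S} > 0"
    using fin by (auto simp: card_gt_0_iff intro: exI[of _ "[]"])
  then have "ln (card {m :: bool list. length m \<le> S}) \<le> ln (4 ^ S)"
    using le by (subst ln_le_cancel_iff) auto
  also have "\<dots> = S * (2 * ln 2)"
    using ln_realpow[of 2 2] by (simp add: ln_realpow)
  also have "\<dots> \<le> real S * 2" using ln_2_less_1 by (intro mult_left_mono) linarith+
  finally show "ln (card {m :: bool list. length m \<le> S}) \<le> 2 * S" by simp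
qed

lemma prob_space_coin_tape: "prob_space coin_tape"
  unfolding coin_tape_def by (intro prob_space_PiM prob_space_measure_pmf)

text \<open>The averaging half of Yao's principle: a bound for each fixed tape on the number of
  inputs solved transfers to the summed success probabilities.\<close>

lemma (in prob_space) sum_prob_le:
  assumes "finite I" and "\<And>i. i \<in> I \<Longrightarrow> E i \<in> events"
    and "\<And>\<omega>. \<omega> \<in> space M \<Longrightarrow> (\<Sum>i\<in>I. indicator (E i) \<omega>) \<le> (B :: real)"
  shows "(\<Sum>i\<in>I. prob (E i)) \<le> B"
proof -
  have int: "integrable M (indicator (E i) :: _ \<Rightarrow> real)" if "i \<in> I" for i
    using assms(2)[OF that] by (simp add: integrable_indicator_iff emeasure_eq_measure)
  have "(\<Sum>i\<in>I. prob (E i)) = (\<integral>\<omega>. (\<Sum>i\<in>I. indicator (E i) \<omega>) \<partial>M)"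
    using assms(1,2) int by (subst Bochner_Integration.integral_sum) (auto intro!: sum.cong)
  also have "\<dots> \<le> B"
    using assms(3) int by (intro integral_le_const Bochner_Integration.integrable_sum) auto
  finally show ?thesis .
qed

lemma success_event_measurable:
  assumes "success_prob A r obj cs > 0"
  shows "{\<omega> \<in> space coin_tape. lp_optimal obj cs (sa_result A r \<omega> obj cs)} \<in> sets coin_tape"
  using assms measure_notin_sets unfolding success_prob_def by fastforce

section \<open>Space bounds for a given algorithm\<close>

lemma space_lower_bound:
  assumes r: "r \<ge> 1" and N: "N \<ge> 1" and n: "N ^ r + N ^ (r - 1) \<le> n"
    and w: "3 ^ (2 * r - 1) * (width N (2 * r - 1))\<^sup>2 < 2 ^ w"
    and space: "uses_space A S" and correct: "finds_lp_optimum A r n w (2 / 3)"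
  shows "real N \<le> 1152 * (real r)\<^sup>2 * real S"
proof -
  interpret prob_space coin_tape by (rule prob_space_coin_tape)
  define k where "k = 2 * r - 1"
  let ?D1 = "first_inputs N k" and ?D2 = "second_inputs N k"
  let ?M = "{m :: bool list. length m \<le> S}"
  have k: "k = Suc (2 * (r - 1))" "Suc k div 2 = r" "k div 2 = r - 1"
    using r by (auto simp: k_def)
  define cs where "cs = (\<lambda>(a, b). first_part N k a @ second_part n N k b)"
  define E where "E = (\<lambda>p. {\<omega> \<in> space coin_tape.
    lp_optimal rightmost (cs p) (sa_result A r \<omega> rightmost (cs p))})"
  \<comment> \<open>With at most \<open>2 * r\<close> messages the \<gamma> terms add up to at most
    1/12, half of the gap between 1/2 and 2/3. The other half has to come from the memory
    term.\<close>
  define \<gamma> :: real where "\<gamma> = 1 / (24 * real r)"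
  define v where "v = 1 / 2 + k * (\<gamma> + ln (card ?M) / (\<gamma> * N))"
  have \<gamma>: "0 < \<gamma>" "\<gamma> \<le> 1" using r by (auto simp: \<gamma>_def)
  have fin: "finite ?D1" "finite ?D2" using finite_inputs by auto
  have cross: "crossing (set (lines N a k)) (set (lines N b k)) (answer N k a b)"
    if "a \<in> ?D1" "b \<in> ?D2" for a b
    using crossing_answer that N by auto
  have E: "prob (E p) \<ge> 2 / 3" "E p \<in> events" if p: "p \<in> ?D1 \<times> ?D2" for p
  proof -
    obtain a b where ab: "p = (a, b)" "a \<in> ?D1" "b \<in> ?D2" using p by blast
    have "length (cs p) = n"
      using n length_lines[of N k] ab by (simp add: cs_def first_part_def second_part_def k(2,3))
    moreover have "lp_precision w rightmost (cs p)"
      using lp_precision_parts[of N a k b w n] ab N w by (simp add: cs_def k_def)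
    moreover have "\<exists>z. lp_optimal rightmost (cs p) z"
      using lp_optimal_crossing(1)[OF cross] ab by (simp add: cs_def)
    ultimately have *: "success_prob A r rightmost (cs p) \<ge> 2 / 3"
      using correct unfolding finds_lp_optimum_def by blast
    then show "prob (E p) \<ge> 2 / 3" by (simp add: E_def success_prob_def)
    show "E p \<in> events" unfolding E_def using * by (intro success_event_measurable) linarith
  qed
  have "(\<Sum>p\<in>?D1 \<times> ?D2. indicator (E p) \<omega>) \<le> v * (card ?D1 * card ?D2)" for \<omega>
  proof -
    let ?msg = "stream_msg A \<omega> (N ^ r) r" and ?out = "stream_out A \<omega> (N ^ r) r"
    let ?m = "sa_init A \<omega> rightmost"
    have result: "play ?msg ?out k (first_part N k a) (second_part n N k b) ?m
        = sa_result A r \<omega> rightmost (cs (a, b)) $ 1" if "a \<in> ?D1" for a b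
    proof -
      have "length (first_part N k a) = N ^ r"
        using that length_lines[of N k] by (simp add: first_part_def k(2,3))
      then show ?thesis
        using play_streaming[of "r - 1" r A \<omega> "first_part N k a" "second_part n N k b"] r
        by (simp add: k(1) cs_def del: play.simps)
    qed
    have "(\<Sum>p\<in>?D1 \<times> ?D2. indicator (E p) \<omega>)
        = (\<Sum>a\<in>?D1. \<Sum>b\<in>?D2. indicator (E (a, b)) \<omega> :: real)"
      by (simp add: sum.cartesian_product)
    also have "\<dots> \<le> (\<Sum>a\<in>?D1. \<Sum>b\<in>?D2. of_bool
        (play ?msg ?out k (first_part N k a) (second_part n N k b) ?m = 0 + of_int (answer N k a b)))"
    proof (intro sum_mono)
      fix a b assume ab: "a \<in> ?D1" "b \<in> ?D2"
      have "sa_result A r \<omega> rightmost (cs (a, b)) $ 1 = answer N k a b" if "\<omega> \<in> E (a, b)"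
        using that
        by (intro lp_optimal_crossing(2)[OF cross[OF ab], of n]) (simp add: E_def cs_def)
      then show "indicator (E (a, b)) \<omega> \<le> (of_bool (play ?msg ?out k
          (first_part N k a) (second_part n N k b) ?m = 0 + of_int (answer N k a b)) :: real)"
        using result[OF ab(1)] by (auto simp: indicator_def)
    qed
    also have "\<dots> \<le> v * (card ?D1 * card ?D2)"
      unfolding v_def
    proof (rule play_success_le)
      show "?m \<in> ?M" using space by (simp add: uses_space_def)
      show "?msg i x m \<in> ?M" if "m \<in> ?M" for i x m
        using length_pass_from[OF space] that by (simp add: stream_msg_def)
    qed (use N \<gamma> card_bit_strings in auto)
    finally show ?thesis .
  qed
  then have "(\<Sum>p\<in>?D1 \<times> ?D2. prob (E p)) \<le> v * (card ?D1 * card ?D2)"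
    using fin E by (intro sum_prob_le) auto
  moreover have "(\<Sum>p\<in>?D1 \<times> ?D2. 2 / 3) \<le> (\<Sum>p\<in>?D1 \<times> ?D2. prob (E p))"
    using E by (intro sum_mono) auto
  ultimately have "2 / 3 * real (card ?D1 * card ?D2) \<le> v * (card ?D1 * card ?D2)"
    by (simp add: card_cartesian_product)
  moreover have "real (card ?D1 * card ?D2) > 0"
    using fin nonempty_inputs[of N k] N by (simp add: card_gt_0_iff)
  ultimately have v: "2 / 3 \<le> v" by (rule mult_right_le_imp_le)
  have "ln (card ?M) / (\<gamma> * N) \<le> 2 * S / (\<gamma> * N)"
    using card_bit_strings(2)[of S] \<gamma> by (intro divide_right_mono) auto
  then have "v \<le> 1 / 2 + k * (\<gamma> + 2 * S / (\<gamma> * N))"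
    unfolding v_def by (intro add_left_mono mult_left_mono) auto
  also have "\<dots> \<le> 1 / 2 + (2 * real r) * (\<gamma> + 2 * S / (\<gamma> * N))"
    using \<gamma> by (intro add_left_mono mult_right_mono) (auto simp: k_def)
  also have "\<dots> = 7 / 12 + 96 * (real r)\<^sup>2 * S / N"
    using r by (simp add: \<gamma>_def field_simps power2_eq_square)
  finally have "1 / 12 \<le> 96 * (real r)\<^sup>2 * S / N" using v by linarith
  then show ?thesis using N by (simp add: field_simps)
qed

text \<open>This covers small \<open>n\<close>. With empty memory the output cannot depend on the
  constraints, yet the programs maximising the first coordinate below 0 and below 1 have disjoint
  success events, and 2/3 + 2/3 > 1.\<close>

lemma space_positive:
  assumes w: "w \<ge> 1" and n: "n \<ge> 1"
    and space: "uses_space A S" and correct: "finds_lp_optimum A r n w (2 / 3)"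
  shows "S \<ge> 1"
proof (rule ccontr)
  interpret prob_space coin_tape by (rule prob_space_coin_tape)
  assume "\<not> S \<ge> 1"
  then have "S = 0" by simp
  with space have space0: "uses_space A 0" by simp
  define cs :: "real \<Rightarrow> lp_constraint list" where "cs = (\<lambda>b. replicate n (rightmost, - b))"
  define E where "E = (\<lambda>b. {\<omega> \<in> space coin_tape.
    lp_optimal rightmost (cs b) (sa_result A r \<omega> rightmost (cs b))})"
  have obj: "rightmost \<bullet> z = - z $ 1" for z
    by (simp add: rightmost_def inner_vec_def sum_2)
  have feas: "lp_feasible (cs b) z \<longleftrightarrow> z $ 1 \<le> b" for b z
    using n by (simp add: lp_feasible_def cs_def obj)
  have opt_exists: "lp_optimal rightmost (cs b) (vector [b, 0])" for b
    by (auto simp: lp_optimal_def is_arg_min_def feas obj)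
  have opt_unique: "z $ 1 = b" if "lp_optimal rightmost (cs b) z" for b z
  proof -
    have "lp_feasible (cs b) (vector [b, 0])" "\<not> rightmost \<bullet> (vector [b, 0]) < rightmost \<bullet> z"
      using that by (auto simp: lp_optimal_def is_arg_min_def feas)
    then show ?thesis using that by (auto simp: lp_optimal_def is_arg_min_def feas obj)
  qed
  have "memory_after A \<omega> rightmost (cs b) p = []" for \<omega> b p
  proof (induction p)
    case 0
    then show ?case using space0 by (simp add: uses_space_def)
  next
    case (Suc p)
    then show ?case
      using length_pass_from[OF space0, of "[]" \<omega> p 0 "cs b"] by (simp add: run_pass_def pass_from_def)
  qed
  then have same: "sa_result A r \<omega> rightmost (cs 0) = sa_result A r \<omega> rightmost (cs 1)" for \<omega>
    by (simp add: sa_result_def)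
  have one: "(1::real) < 2 ^ w" using w by (simp add: one_less_power)
  have E: "prob (E b) \<ge> 2 / 3" "E b \<in> events" if "b \<in> {0, 1}" for b
  proof -
    have "lp_precision w rightmost (cs b)"
      using that one by (auto simp: lp_precision_def cs_def rightmost_def forall_2 word_int_def)
    moreover have "length (cs b) = n" by (simp add: cs_def)
    ultimately have *: "success_prob A r rightmost (cs b) \<ge> 2 / 3"
      using correct opt_exists unfolding finds_lp_optimum_def by blast
    then show "prob (E b) \<ge> 2 / 3" by (simp add: E_def success_prob_def)
    show "E b \<in> events" unfolding E_def using * by (intro success_event_measurable) linarith
  qed
  have "E 0 \<inter> E 1 = {}"
  proof (rule equals0I)
    fix \<omega> assume "\<omega> \<in> E 0 \<inter> E 1"
    then have "sa_result A r \<omega> rightmost (cs 1) $ 1 = 0" "sa_result A r \<omega> rightmost (cs 1) $ 1 = 1"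
      using opt_unique same unfolding E_def by auto
    then show False by simp
  qed
  then have "prob (E 0 \<union> E 1) = prob (E 0) + prob (E 1)"
    using E by (intro finite_measure_Union) auto
  then show False using E[of 0] E[of 1] prob_le_1[of "E 0 \<union> E 1"] by simp
qed

theorem theorem5p22:
  "\<exists>(c::real) > 0. \<exists>K::nat. \<forall>(r::nat) \<ge> 1. \<forall>(n::nat) \<ge> 1. \<forall>(w::nat) (S::nat) (A::streaming_algorithm).
     real w \<ge> real K * log 2 (real n + 1) \<and>
     uses_space A S \<and>
     finds_lp_optimum A r n w (2 / 3)
     \<longrightarrow> real S \<ge> c * (1 / real r ^ 3 * real n powr (1 / (2 * real r)))"
proof (intro exI[of _ "1 / 2304"] exI[of _ 8] conjI allI impI)
  fix r n w S :: nat and A :: streaming_algorithm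
  assume r: "1 \<le> r" and n: "1 \<le> n"
    and "real w \<ge> real 8 * log 2 (real n + 1) \<and> uses_space A S \<and> finds_lp_optimum A r n w (2 / 3)"
  then have w: "real w \<ge> 8 * log 2 (real n + 1)" and space: "uses_space A S"
    and correct: "finds_lp_optimum A r n w (2 / 3)"
    by auto
  define y where "y = real n powr (1 / (2 * real r))"
  \<comment> \<open>This makes \<open>N ^ (2 * r) \<le> n\<close>, which leaves room for all lines
    once \<open>N \<ge> 2\<close>. Rounding down then costs at most a factor 2, whence 2304 = 2 *
    1152.\<close>
  define N where "N = nat \<lfloor>y\<rfloor>"
  have r3: "1 \<le> real r ^ 3" using r by simp
  have "log 2 (real n + 1) \<ge> 1" using n by (simp add: le_log_iff)
  then have "real w \<ge> 1" using w by linarith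
  then have w1: "w \<ge> 1" by simp
  show "real S \<ge> 1 / 2304 * (1 / real r ^ 3 * real n powr (1 / (2 * real r)))"
    unfolding y_def[symmetric]
  proof (cases "y < 2")
    case True
    have "1 \<le> real S" using space_positive[OF w1 n space correct] by simp
    moreover have "1 / real r ^ 3 * y \<le> 1 * 2"
      using True r3 r by (intro mult_mono) (auto simp: y_def)
    ultimately show "1 / 2304 * (1 / real r ^ 3 * y) \<le> real S" by linarith
  next
    case False
    then have "2 \<le> \<lfloor>y\<rfloor>" by (simp add: le_floor_iff)
    then have N2: "N \<ge> 2" and Ny: "real N \<le> y" "y \<le> 2 * real N"
      unfolding N_def by (linarith, simp, linarith)
    have "real N ^ (2 * r) \<le> y ^ (2 * r)" using Ny by (intro power_mono) auto
    also have "\<dots> = real n"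
      using r n unfolding y_def by (simp add: powr_powr flip: powr_realpow)
    finally have "real (N ^ (2 * r)) \<le> real n" by simp
    then have Nn: "N ^ (2 * r) \<le> n" by (simp only: of_nat_le_iff)
    have "N ^ 1 \<le> N ^ r" using N2 r by (intro power_increasing) auto
    then have "2 * N ^ r \<le> N ^ r * N ^ r" using N2 by (intro mult_right_mono) auto
    moreover have "N ^ (r - 1) \<le> N ^ r" using N2 by (intro power_increasing) auto
    ultimately have cons: "N ^ r + N ^ (r - 1) \<le> n"
      using Nn by (simp add: mult_2 power_add)
    \<comment> \<open>The precision constant 8 arises here: 48 N^2 \<le> N^8 for
      \<open>N \<ge> 2\<close>, and \<open>N ^ (2 * r) \<le> n\<close> turns this into the
      coefficient bound n^8.\<close>
    have "3 ^ (2 * r - 1) * (width N (2 * r - 1))\<^sup>2 = (48 * int N ^ 2) ^ (2 * r - 1)"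
    proof -
      have "48 * int N ^ 2 = 3 * (4 * int N)\<^sup>2" by (simp add: power2_eq_square)
      then show ?thesis
        unfolding width_def by (metis power_mult_distrib power_mult mult.commute)
    qed
    also have "\<dots> \<le> (int N ^ 8) ^ (2 * r - 1)"
    proof (intro power_mono)
      have "(2::int) ^ 6 \<le> int N ^ 6" using N2 by (intro power_mono) auto
      then have "48 * int N ^ 2 \<le> int N ^ 6 * int N ^ 2" by (intro mult_right_mono) auto
      then show "48 * int N ^ 2 \<le> int N ^ 8" by (simp flip: power_add)
    qed simp
    also have "\<dots> \<le> (int N ^ 8) ^ (2 * r)" using N2 by (intro power_increasing) auto
    also have "\<dots> = int (N ^ (2 * r)) ^ 8" by (metis of_nat_power mult.commute power_mult)
    also have "\<dots> \<le> int n ^ 8" using Nn by (intro power_mono) auto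
    also have "\<dots> < (int n + 1) ^ 8" by (intro power_strict_mono) auto
    also have "\<dots> \<le> 2 ^ w"
    proof -
      have "(real n + 1) ^ 8 = 2 powr (8 * log 2 (real n + 1))"
        using powr_powr[of 2 "log 2 (real n + 1)" 8] by (simp add: mult.commute)
      also have "\<dots> \<le> 2 powr (real w)" using w by (intro powr_mono) auto
      finally have "real_of_int ((int n + 1) ^ 8) \<le> of_int (2 ^ w)" by (simp add: powr_realpow)
      then show ?thesis by (simp only: of_int_le_iff)
    qed
    finally have "real N \<le> 1152 * (real r)\<^sup>2 * real S"
      using r N2 cons space correct by (intro space_lower_bound) auto
    then have "y \<le> 2304 * (real r)\<^sup>2 * real S" using Ny by linarith
    also have "\<dots> \<le> 2304 * real r ^ 3 * real S"
      using r by (intro mult_right_mono mult_left_mono power_increasing) auto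
    finally show "1 / 2304 * (1 / real r ^ 3 * y) \<le> real S"
      using r by (simp add: field_simps)
  qed
qed simp

end
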